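(* The first-order theory of (co)datatypes (with the standard semantics for selectors) is undecidable: there is no algorithm that, given a (co)datatype signature and a first-order sentence over it, decides whether the sentence is true in every structure of (co)datatypes for that signature.
   Context: A (co)datatype signature consists of a set of sorts $S = S_{dt} \cup S_{ct}$ partitioned into datatypes $S_{dt}$ and codatatypes $S_{ct}$, and function symbols partitioned into constructors and selectors; there are no predicate symbols. Each (co)datatype $\delta$ has $m \ge 1$ constructors $C_1,\dots,C_m$; each constructor $C$ has an arity $\delta_1 \times \cdots \times \delta_n \to \delta$ and comes with $n$ selectors $\mathrm{sel}_C^j : \delta \to \delta_j$ ($j=1,\dots,n$). All constructor arguments of a datatype are datatypes and all constructor arguments of a codatatype are codatatypes. Datatypes are well-founded: every datatype has a ground constructor term. A constructor tree of sort $\delta$ is a (possibly infinite) rooted ordered tree whose root is labeled by a constructor $C:\delta_1\times\cdots\times\delta_n\to\delta$ and whose $n$ children, in order, are roots of constructor trees of sorts $\delta_1,\dots,\delta_n$. A structure of (co)datatypes interprets each codatatype $\gamma$ as the set of all constructor trees of sort $\gamma$, each datatype $\delta$ as the set of finite constructor trees of sort $\delta$, each constructor $C$ as the map sending $(t_1,\dots,t_n)$ to the tree with root labeled $C$ and subtrees $t_1,\dots,t_n$, and each selector $\mathrm{sel}_C^i$ as some function satisfying $\mathrm{sel}_C^i(C(t_1,\dots,t_n)) = t_i$; its values on trees whose root is not $C$ are arbitrary (standard semantics). The theory of (co)datatypes is the set of sentences true in every structure of (co)datatypes. *)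

theory Defs
  imports Main "HOL-Library.Nat_Bijection"
begin

section \<open>Signatures\<close>

text \<open>
  A signature is a finite list of sort declarations. Sorts are the indices into this list. The
  constructors of a sort are the indices into its list of argument-sort lists, so that the
  constructor \<open>c\<close> of sort \<open>\<delta>\<close> has arity \<open>(ctors \<Sigma> \<delta> ! c) \<rightarrow> \<delta>\<close>. Its selectors are indexed by
  argument position, from 0.
\<close>

datatype kind = Datatype | Codatatype

type_synonym signature = "(kind \<times> nat list list) list"

definition kind_of :: "signature \<Rightarrow> nat \<Rightarrow> kind" where
  "kind_of \<Sigma> \<delta> = fst (\<Sigma> ! \<delta>)"

definition ctors :: "signature \<Rightarrow> nat \<Rightarrow> nat list list" where
  "ctors \<Sigma> \<delta> = snd (\<Sigma> ! \<delta>)"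

definition is_ctor :: "signature \<Rightarrow> nat \<Rightarrow> nat \<Rightarrow> bool" where
  "is_ctor \<Sigma> \<delta> c \<longleftrightarrow> \<delta> < length \<Sigma> \<and> c < length (ctors \<Sigma> \<delta>)"

definition is_sel :: "signature \<Rightarrow> nat \<Rightarrow> nat \<Rightarrow> nat \<Rightarrow> bool" where
  "is_sel \<Sigma> \<delta> c j \<longleftrightarrow> is_ctor \<Sigma> \<delta> c \<and> j < length (ctors \<Sigma> \<delta> ! c)"


section \<open>First-order syntax\<close>

text \<open>\<open>Var \<delta> x\<close> is the variable of sort \<open>\<delta>\<close> named \<open>x\<close>; variables of distinct sorts are distinct.\<close>

datatype tm =
    Var nat nat
  | Con nat nat "tm list"
  | Sel nat nat nat tm

datatype fm =
    Eq tm tm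
  | Bot
  | Neg fm
  | And fm fm
  | Or fm fm
  | Imp fm fm
  | All nat nat fm
  | Ex nat nat fm

inductive has_sort :: "signature \<Rightarrow> tm \<Rightarrow> nat \<Rightarrow> bool" for \<Sigma> where
  "\<delta> < length \<Sigma> \<Longrightarrow> has_sort \<Sigma> (Var \<delta> x) \<delta>"
| "is_ctor \<Sigma> \<delta> c \<Longrightarrow> list_all2 (has_sort \<Sigma>) ts (ctors \<Sigma> \<delta> ! c) \<Longrightarrow> has_sort \<Sigma> (Con \<delta> c ts) \<delta>"
| "is_sel \<Sigma> \<delta> c j \<Longrightarrow> has_sort \<Sigma> t \<delta> \<Longrightarrow> has_sort \<Sigma> (Sel \<delta> c j t) (ctors \<Sigma> \<delta> ! c ! j)"

fun ground_ctor_tm :: "tm \<Rightarrow> bool" where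
  "ground_ctor_tm (Var \<delta> x) \<longleftrightarrow> False"
| "ground_ctor_tm (Con \<delta> c ts) \<longleftrightarrow> (\<forall>t \<in> set ts. ground_ctor_tm t)"
| "ground_ctor_tm (Sel \<delta> c j t) \<longleftrightarrow> False"

definition codt_signature :: "signature \<Rightarrow> bool" where
  "codt_signature \<Sigma> \<longleftrightarrow>
    (\<forall>\<delta> < length \<Sigma>. ctors \<Sigma> \<delta> \<noteq> []) \<and>
    (\<forall>\<delta> < length \<Sigma>. \<forall>args \<in> set (ctors \<Sigma> \<delta>). \<forall>\<delta>' \<in> set args.
       \<delta>' < length \<Sigma> \<and> kind_of \<Sigma> \<delta>' = kind_of \<Sigma> \<delta>) \<and>
    (\<forall>\<delta> < length \<Sigma>. kind_of \<Sigma> \<delta> = Datatype \<longrightarrow> (\<exists>t. ground_ctor_tm t \<and> has_sort \<Sigma> t \<delta>))"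

primrec wf_fm :: "signature \<Rightarrow> fm \<Rightarrow> bool" where
  "wf_fm \<Sigma> (Eq t u) \<longleftrightarrow> (\<exists>\<delta>. has_sort \<Sigma> t \<delta> \<and> has_sort \<Sigma> u \<delta>)"
| "wf_fm \<Sigma> Bot \<longleftrightarrow> True"
| "wf_fm \<Sigma> (Neg \<phi>) \<longleftrightarrow> wf_fm \<Sigma> \<phi>"
| "wf_fm \<Sigma> (And \<phi> \<psi>) \<longleftrightarrow> wf_fm \<Sigma> \<phi> \<and> wf_fm \<Sigma> \<psi>"
| "wf_fm \<Sigma> (Or \<phi> \<psi>) \<longleftrightarrow> wf_fm \<Sigma> \<phi> \<and> wf_fm \<Sigma> \<psi>"
| "wf_fm \<Sigma> (Imp \<phi> \<psi>) \<longleftrightarrow> wf_fm \<Sigma> \<phi> \<and> wf_fm \<Sigma> \<psi>"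
| "wf_fm \<Sigma> (All \<delta> x \<phi>) \<longleftrightarrow> \<delta> < length \<Sigma> \<and> wf_fm \<Sigma> \<phi>"
| "wf_fm \<Sigma> (Ex \<delta> x \<phi>) \<longleftrightarrow> \<delta> < length \<Sigma> \<and> wf_fm \<Sigma> \<phi>"

fun vars_tm :: "tm \<Rightarrow> (nat \<times> nat) set" where
  "vars_tm (Var \<delta> x) = {(\<delta>, x)}"
| "vars_tm (Con \<delta> c ts) = (\<Union>t \<in> set ts. vars_tm t)"
| "vars_tm (Sel \<delta> c j t) = vars_tm t"

primrec free_vars :: "fm \<Rightarrow> (nat \<times> nat) set" where
  "free_vars (Eq t u) = vars_tm t \<union> vars_tm u"
| "free_vars Bot = {}"
| "free_vars (Neg \<phi>) = free_vars \<phi>"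
| "free_vars (And \<phi> \<psi>) = free_vars \<phi> \<union> free_vars \<psi>"
| "free_vars (Or \<phi> \<psi>) = free_vars \<phi> \<union> free_vars \<psi>"
| "free_vars (Imp \<phi> \<psi>) = free_vars \<phi> \<union> free_vars \<psi>"
| "free_vars (All \<delta> x \<phi>) = free_vars \<phi> - {(\<delta>, x)}"
| "free_vars (Ex \<delta> x \<phi>) = free_vars \<phi> - {(\<delta>, x)}"

definition sentence :: "signature \<Rightarrow> fm \<Rightarrow> bool" where
  "sentence \<Sigma> \<phi> \<longleftrightarrow> wf_fm \<Sigma> \<phi> \<and> free_vars \<phi> = {}"


section \<open>First-order semantics\<close>

record 'a fo_structure =
  carrier :: "nat \<Rightarrow> 'a set"
  con_interp :: "nat \<Rightarrow> nat \<Rightarrow> 'a list \<Rightarrow> 'a"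
  sel_interp :: "nat \<Rightarrow> nat \<Rightarrow> nat \<Rightarrow> 'a \<Rightarrow> 'a"

fun eval_tm :: "'a fo_structure \<Rightarrow> (nat \<times> nat \<Rightarrow> 'a) \<Rightarrow> tm \<Rightarrow> 'a" where
  "eval_tm M v (Var \<delta> x) = v (\<delta>, x)"
| "eval_tm M v (Con \<delta> c ts) = con_interp M \<delta> c (map (eval_tm M v) ts)"
| "eval_tm M v (Sel \<delta> c j t) = sel_interp M \<delta> c j (eval_tm M v t)"

primrec sat :: "'a fo_structure \<Rightarrow> (nat \<times> nat \<Rightarrow> 'a) \<Rightarrow> fm \<Rightarrow> bool" where
  "sat M v (Eq t u) \<longleftrightarrow> eval_tm M v t = eval_tm M v u"
| "sat M v Bot \<longleftrightarrow> False"
| "sat M v (Neg \<phi>) \<longleftrightarrow> \<not> sat M v \<phi>"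
| "sat M v (And \<phi> \<psi>) \<longleftrightarrow> sat M v \<phi> \<and> sat M v \<psi>"
| "sat M v (Or \<phi> \<psi>) \<longleftrightarrow> sat M v \<phi> \<or> sat M v \<psi>"
| "sat M v (Imp \<phi> \<psi>) \<longleftrightarrow> (sat M v \<phi> \<longrightarrow> sat M v \<psi>)"
| "sat M v (All \<delta> x \<phi>) \<longleftrightarrow> (\<forall>a \<in> carrier M \<delta>. sat M (v((\<delta>, x) := a)) \<phi>)"
| "sat M v (Ex \<delta> x \<phi>) \<longleftrightarrow> (\<exists>a \<in> carrier M \<delta>. sat M (v((\<delta>, x) := a)) \<phi>)"

definition valuation :: "signature \<Rightarrow> 'a fo_structure \<Rightarrow> (nat \<times> nat \<Rightarrow> 'a) \<Rightarrow> bool" where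
  "valuation \<Sigma> M v \<longleftrightarrow> (\<forall>\<delta> < length \<Sigma>. \<forall>x. v (\<delta>, x) \<in> carrier M \<delta>)"

definition true_in :: "signature \<Rightarrow> 'a fo_structure \<Rightarrow> fm \<Rightarrow> bool" where
  "true_in \<Sigma> M \<phi> \<longleftrightarrow> (\<forall>v. valuation \<Sigma> M v \<longrightarrow> sat M v \<phi>)"


section \<open>Structures of (co)datatypes\<close>

text \<open>A node is labelled by a constructor, given as the pair of its sort and its index.\<close>

codatatype ctree = Node (label: "nat \<times> nat") (children: "ctree list")

coinductive ctor_tree :: "signature \<Rightarrow> nat \<Rightarrow> ctree \<Rightarrow> bool" for \<Sigma> where
  "is_ctor \<Sigma> \<delta> c \<Longrightarrow> list_all2 (ctor_tree \<Sigma>) (ctors \<Sigma> \<delta> ! c) ts \<Longrightarrow> ctor_tree \<Sigma> \<delta> (Node (\<delta>, c) ts)"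

text \<open>The nodes of a tree are identified with the paths of child positions leading to them.\<close>

primrec has_node :: "nat list \<Rightarrow> ctree \<Rightarrow> bool" where
  "has_node [] t \<longleftrightarrow> True"
| "has_node (i # p) t \<longleftrightarrow> i < length (children t) \<and> has_node p (children t ! i)"

definition finite_tree :: "ctree \<Rightarrow> bool" where
  "finite_tree t \<longleftrightarrow> finite {p. has_node p t}"

definition sort_trees :: "signature \<Rightarrow> nat \<Rightarrow> ctree set" where
  "sort_trees \<Sigma> \<delta> =
    (case kind_of \<Sigma> \<delta> of
       Datatype \<Rightarrow> {t. ctor_tree \<Sigma> \<delta> t \<and> finite_tree t}
     | Codatatype \<Rightarrow> {t. ctor_tree \<Sigma> \<delta> t})"

text \<open>
  The interpretations are constrained only for the sorts and function symbols of the signature and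
  only on arguments from the carriers. Selectors are unconstrained on trees with another root
  constructor, except that their values lie in the carrier of the argument sort.
\<close>

definition codt_structure :: "signature \<Rightarrow> ctree fo_structure \<Rightarrow> bool" where
  "codt_structure \<Sigma> M \<longleftrightarrow>
    (\<forall>\<delta> < length \<Sigma>. carrier M \<delta> = sort_trees \<Sigma> \<delta>) \<and>
    (\<forall>\<delta> c ts. is_ctor \<Sigma> \<delta> c \<longrightarrow> list_all2 (\<lambda>t \<delta>'. t \<in> carrier M \<delta>') ts (ctors \<Sigma> \<delta> ! c) \<longrightarrow>
       con_interp M \<delta> c ts = Node (\<delta>, c) ts) \<and>
    (\<forall>\<delta> c j. is_sel \<Sigma> \<delta> c j \<longrightarrow>
       (\<forall>t \<in> carrier M \<delta>. sel_interp M \<delta> c j t \<in> carrier M (ctors \<Sigma> \<delta> ! c ! j)) \<and>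
       (\<forall>ts. list_all2 (\<lambda>t \<delta>'. t \<in> carrier M \<delta>') ts (ctors \<Sigma> \<delta> ! c) \<longrightarrow>
          sel_interp M \<delta> c j (con_interp M \<delta> c ts) = ts ! j))"

definition codt_theory :: "signature \<Rightarrow> fm set" where
  "codt_theory \<Sigma> = {\<phi>. sentence \<Sigma> \<phi> \<and> (\<forall>M. codt_structure \<Sigma> M \<longrightarrow> true_in \<Sigma> M \<phi>)}"


section \<open>Algorithms\<close>

text \<open>
  Algorithms are partial recursive functions. \<open>computes f xs y\<close> states that the function denoted
  by \<open>f\<close> is defined on the arguments \<open>xs\<close> with value \<open>y\<close>. Primitive recursion recurses on the first
  argument, and minimization searches for the first argument.
\<close>

datatype recf =
    Zero
  | Succ
  | Proj nat
  | Comp recf "recf list"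
  | PrimRec recf recf
  | Mu recf

inductive computes :: "recf \<Rightarrow> nat list \<Rightarrow> nat \<Rightarrow> bool" where
  Zero: "computes Zero xs 0"
| Succ: "computes Succ [x] (Suc x)"
| Proj: "i < length xs \<Longrightarrow> computes (Proj i) xs (xs ! i)"
| Comp: "list_all2 (\<lambda>g y. computes g xs y) gs ys \<Longrightarrow> computes f ys z \<Longrightarrow> computes (Comp f gs) xs z"
| PrimRec_0: "computes f xs y \<Longrightarrow> computes (PrimRec f g) (0 # xs) y"
| PrimRec_Suc: "computes (PrimRec f g) (n # xs) y \<Longrightarrow> computes g (n # y # xs) z \<Longrightarrow>
    computes (PrimRec f g) (Suc n # xs) z"
| Mu: "computes f (n # xs) 0 \<Longrightarrow> (\<forall>i < n. \<exists>y > 0. computes f (i # xs) y) \<Longrightarrow> computes (Mu f) xs n"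

text \<open>
  \<open>decidable enc I P\<close>: some algorithm, given the code of any instance in \<open>I\<close>, halts and tells
  whether the instance is in \<open>P\<close>. Nothing is required of inputs that do not encode an instance.
\<close>

definition decidable :: "('a \<Rightarrow> nat) \<Rightarrow> 'a set \<Rightarrow> 'a set \<Rightarrow> bool" where
  "decidable enc I P \<longleftrightarrow> (\<exists>f. \<forall>x \<in> I. computes f [enc x] (if x \<in> P then 1 else 0))"


section \<open>Encoding of the inputs\<close>

fun encode_tm :: "tm \<Rightarrow> nat" where
  "encode_tm (Var \<delta> x) = list_encode [0, \<delta>, x]"
| "encode_tm (Con \<delta> c ts) = list_encode (1 # \<delta> # c # map encode_tm ts)"
| "encode_tm (Sel \<delta> c j t) = list_encode [2, \<delta>, c, j, encode_tm t]"

primrec encode_fm :: "fm \<Rightarrow> nat" where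
  "encode_fm (Eq t u) = list_encode [0, encode_tm t, encode_tm u]"
| "encode_fm Bot = list_encode [1]"
| "encode_fm (Neg \<phi>) = list_encode [2, encode_fm \<phi>]"
| "encode_fm (And \<phi> \<psi>) = list_encode [3, encode_fm \<phi>, encode_fm \<psi>]"
| "encode_fm (Or \<phi> \<psi>) = list_encode [4, encode_fm \<phi>, encode_fm \<psi>]"
| "encode_fm (Imp \<phi> \<psi>) = list_encode [5, encode_fm \<phi>, encode_fm \<psi>]"
| "encode_fm (All \<delta> x \<phi>) = list_encode [6, \<delta>, x, encode_fm \<phi>]"
| "encode_fm (Ex \<delta> x \<phi>) = list_encode [7, \<delta>, x, encode_fm \<phi>]"

primrec encode_kind :: "kind \<Rightarrow> nat" where
  "encode_kind Datatype = 0"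
| "encode_kind Codatatype = 1"

definition encode_signature :: "signature \<Rightarrow> nat" where
  "encode_signature \<Sigma> =
    list_encode (map (\<lambda>(k, cs). prod_encode (encode_kind k, list_encode (map list_encode cs))) \<Sigma>)"

definition encode_instance :: "signature \<times> fm \<Rightarrow> nat" where
  "encode_instance = (\<lambda>(\<Sigma>, \<phi>). prod_encode (encode_signature \<Sigma>, encode_fm \<phi>))"

lemma list_encode_eq_iff: "list_encode xs = list_encode ys \<longleftrightarrow> xs = ys"
  by (metis list_encode_inverse)

lemma encode_tm_inject: "encode_tm t = encode_tm u \<Longrightarrow> t = u"
proof (induction t arbitrary: u rule: encode_tm.induct)
  case (1 \<delta> x)
  then show ?case by (cases u; simp only: encode_tm.simps list_encode_eq_iff list.inject; auto)
next
  case (2 \<delta> c ts)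
  show ?case
  proof (cases u)
    case (Con \<delta>' c' us)
    with 2(2) have "map encode_tm ts = map encode_tm us" "\<delta> = \<delta>'" "c = c'"
      by (auto simp only: encode_tm.simps list_encode_eq_iff list.inject)
    then have "ts = us"
      using 2(1) by (auto simp: list_eq_iff_nth_eq)
    with Con \<open>\<delta> = \<delta>'\<close> \<open>c = c'\<close> show ?thesis by simp
  qed (use 2(2) in \<open>simp only: encode_tm.simps list_encode_eq_iff list.inject; simp\<close>)+
next
  case (3 \<delta> c j t)
  then show ?case by (cases u; simp only: encode_tm.simps list_encode_eq_iff list.inject; auto)
qed

lemma encode_fm_inject: "encode_fm \<phi> = encode_fm \<psi> \<Longrightarrow> \<phi> = \<psi>"
  by (induction \<phi> arbitrary: \<psi>;
      case_tac \<psi>;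
      simp only: encode_fm.simps list_encode_eq_iff list.inject;
      (simp; fail)?; metis encode_tm_inject)

lemma inj_encode_signature: "inj encode_signature"
proof -
  have kind: "encode_kind k = encode_kind k' \<longleftrightarrow> k = k'" for k k'
    by (cases k; cases k'; simp)
  have "inj (map list_encode)"
    by (simp add: inj_def inj_map_eq_map list_encode_eq_iff)
  then have "inj (\<lambda>(k, cs). prod_encode (encode_kind k, list_encode (map list_encode cs)))"
    by (auto simp: inj_def list_encode_eq_iff kind)
  then show ?thesis
    by (auto simp: inj_def encode_signature_def list_encode_eq_iff inj_map_eq_map)
qed

lemma inj_encode_instance: "inj encode_instance"
  by (auto intro!: injI simp: encode_instance_def
      dest: encode_fm_inject injD[OF inj_encode_signature])

lemma computes_deterministic: "computes f xs y \<Longrightarrow> computes f xs z \<Longrightarrow> y = z"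
proof (induction arbitrary: z rule: computes.induct)
  case (Comp xs gs ys f z z')
  from Comp.prems obtain ys' where ys': "list_all2 (\<lambda>g y. computes g xs y) gs ys'"
    and z': "computes f ys' z'"
    by cases auto
  have "ys = ys'"
    using Comp.IH(1) ys' by (auto simp: list_all2_conv_all_nth list_eq_iff_nth_eq)
  with Comp.IH(2) z' show ?case by blast
next
  case (PrimRec_Suc f g n xs y z z')
  from PrimRec_Suc.prems obtain y' where "computes (PrimRec f g) (n # xs) y'"
    and "computes g (n # y' # xs) z'"
    by cases auto
  with PrimRec_Suc.IH show ?case by blast
next
  case (Mu f n xs m)
  from Mu.prems have m: "computes f (m # xs) 0" "\<forall>i < m. \<exists>y > 0. computes f (i # xs) y"
    by (cases, auto)+
  have "\<not> m < n" using Mu.IH(2) m(1) by fastforce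
  moreover have "\<not> n < m" using Mu.IH(1) m(2) by fastforce
  ultimately show ?case by simp
qed (erule computes.cases; simp)+

end

theory Submission
  imports Defs
begin

text \<open>
  A selector is unconstrained on trees with another root constructor, so truth in all structures
  amounts to universal quantification over a predicate on a datatype. Take datatypes for natural
  numbers, lists of natural numbers, partial recursive functions and judgements about computations.
  The rules defining \<open>computes\<close> are Horn clauses, hence the assertion that a predicate on judgements
  closed under the rules holds of \<open>g(x) = 0\<close> is true in all structures iff \<open>g\<close> has value 0 at \<open>x\<close>.
  The sentence saying that a formula holds of its own code is computable from that code without any
  decoding. A decision procedure composed with this map is thus refuted by the sentence asserting
  its own rejection.
\<close>

section \<open>Finite trees\<close>

lemma nodes_Node:
  "{p. has_node p (Node l ts)} = insert [] (\<Union>i<length ts. (#) i ` {p. has_node p (ts ! i)})"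
proof (rule set_eqI)
  fix p
  show "p \<in> {p. has_node p (Node l ts)}
    \<longleftrightarrow> p \<in> insert [] (\<Union>i<length ts. (#) i ` {p. has_node p (ts ! i)})"
    by (cases p) auto
qed

text \<open>A node has finitely many children, so its paths are the root path and finitely many
  injective copies of the children's path sets.\<close>

lemma finite_tree_Node: "finite_tree (Node l ts) \<longleftrightarrow> (\<forall>t \<in> set ts. finite_tree t)"
proof -
  have "finite ((#) i ` A) \<longleftrightarrow> finite A" for i :: nat and A
    by (auto intro: finite_imageD)
  then show ?thesis
    by (auto simp: finite_tree_def nodes_Node all_set_conv_all_nth)
qed

text \<open>A codatatype has no structural induction, so the number of nodes is the measure:
  prefixing the child position embeds the paths of a child into those of the parent and misses the
  root path.\<close>

lemma finite_tree_induct [consumes 1, case_names Node]: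
  assumes "finite_tree t"
    and step: "\<And>l ts. (\<And>t. t \<in> set ts \<Longrightarrow> P t) \<Longrightarrow> P (Node l ts)"
  shows "P t"
  using assms(1)
proof (induction "card {p. has_node p t}" arbitrary: t rule: less_induct)
  case less
  obtain l ts where t: "t = Node l ts" by (cases t)
  have "P u" if u: "u \<in> set ts" for u
  proof -
    obtain i where i: "i < length ts" "u = ts ! i"
      using u by (auto simp: in_set_conv_nth)
    have "card {p. has_node p u} = card ((#) i ` {p. has_node p u})"
      by (rule card_image[symmetric]) simp
    also have "\<dots> < card {p. has_node p t}"
    proof (rule psubset_card_mono)
      show "finite {p. has_node p t}"
        using less.prems by (simp add: finite_tree_def)
      show "(#) i ` {p. has_node p u} \<subset> {p. has_node p t}"
        using i unfolding t nodes_Node by blast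
    qed
    finally show "P u"
      using less.hyps less.prems u by (simp add: t finite_tree_Node)
  qed
  then show ?case
    unfolding t by (rule step)
qed


section \<open>The signature\<close>

text \<open>
  The sorts 0 to 4 are: natural numbers, lists of natural numbers, partial recursive functions,
  lists of partial recursive functions, judgements. The last constructor of judgements serves only
  to provide the selector.
\<close>

definition sig :: signature where
  "sig = [(Datatype, [[], [0]]), (Datatype, [[], [0, 1]]),
    (Datatype, [[], [], [0], [2, 3], [2, 2], [2]]), (Datatype, [[], [2, 3]]),
    (Datatype, [[2, 1, 0], [3, 1, 1], [0, 1, 0], [2, 0, 1], [0]])]"

lemma length_sig [simp]: "length sig = 5"
  by (simp add: sig_def)

lemma ctors_sig [simp]:
  "ctors sig 0 = [[], [0]]"
  "ctors sig (Suc 0) = [[], [0, 1]]"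
  "ctors sig 2 = [[], [], [0], [2, 3], [2, 2], [2]]"
  "ctors sig 3 = [[], [2, 3]]"
  "ctors sig 4 = [[2, 1, 0], [3, 1, 1], [0, 1, 0], [2, 0, 1], [0]]"
  by (simp_all add: ctors_def sig_def)

lemma less_5_iff: "n < 5 \<longleftrightarrow> n = 0 \<or> n = Suc 0 \<or> n = 2 \<or> n = 3 \<or> n = (4 :: nat)"
  by auto

lemma kind_of_sig: "\<delta> < 5 \<Longrightarrow> kind_of sig \<delta> = Datatype"
  by (auto simp: less_5_iff kind_of_def sig_def)

lemma args_sig: "is_ctor sig \<delta> c \<Longrightarrow> d \<in> set (ctors sig \<delta> ! c) \<Longrightarrow> d < 5"
  by (auto simp: is_ctor_def less_5_iff less_Suc_eq)

lemma has_sort_iff [simp]: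
  "has_sort \<Sigma> (Var \<delta> x) s \<longleftrightarrow> s = \<delta> \<and> \<delta> < length \<Sigma>"
  "has_sort \<Sigma> (Con \<delta> c ts) s \<longleftrightarrow>
    s = \<delta> \<and> is_ctor \<Sigma> \<delta> c \<and> list_all2 (has_sort \<Sigma>) ts (ctors \<Sigma> \<delta> ! c)"
  "has_sort \<Sigma> (Sel \<delta> c j t) s \<longleftrightarrow>
    s = ctors \<Sigma> \<delta> ! c ! j \<and> is_sel \<Sigma> \<delta> c j \<and> has_sort \<Sigma> t \<delta>"
  by (auto elim: has_sort.cases intro: has_sort.intros)

lemma codt_signature_sig: "codt_signature sig"
proof -
  have "\<exists>t. ground_ctor_tm t \<and> has_sort sig t \<delta>" if "\<delta> < 5" for \<delta>
  proof -
    \<comment> \<open>Constructor 0 is nullary in sorts 0 to 3. Judgements have no nullary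
      constructor, so their constructor 4 is applied to zero.\<close>
    have "has_sort sig (if \<delta> = 4 then Con 4 4 [Con 0 0 []] else Con \<delta> 0 []) \<delta>"
      using that by (auto simp: less_5_iff is_ctor_def)
    then show ?thesis
      by (intro exI[of _ "if \<delta> = 4 then Con 4 4 [Con 0 0 []] else Con \<delta> 0 []"]) auto
  qed
  then show ?thesis
    by (auto simp: codt_signature_def less_5_iff kind_of_sig)
qed

text \<open>One-level unfolding of the carriers: all sorts are datatypes, and a tree is finite iff
  its children are. As a rewrite rule it would loop, hence the uses by \<open>subst\<close> and
  \<open>THEN\<close>.\<close>

lemma sort_trees_sig:
  assumes "\<delta> < 5"
  shows "t \<in> sort_trees sig \<delta> \<longleftrightarrow> (\<exists>c ts. t = Node (\<delta>, c) ts \<and> c < length (ctors sig \<delta>) \<and>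
    list_all2 (\<lambda>d u. u \<in> sort_trees sig d) (ctors sig \<delta> ! c) ts)"
proof -
  have mem: "u \<in> sort_trees sig d \<longleftrightarrow> ctor_tree sig d u \<and> finite_tree u" if "d < 5" for u d
    using that by (simp add: sort_trees_def kind_of_sig)
  have "list_all2 (\<lambda>d u. u \<in> sort_trees sig d) (ctors sig \<delta> ! c) ts \<longleftrightarrow>
      list_all2 (ctor_tree sig) (ctors sig \<delta> ! c) ts \<and> (\<forall>u \<in> set ts. finite_tree u)"
    if "is_ctor sig \<delta> c" for c ts
    using args_sig[OF that]
    by (auto simp: list_all2_conv_all_nth all_set_conv_all_nth mem)
  then show ?thesis
    using assms
    by (subst mem, simp, subst ctor_tree.simps) (auto simp: finite_tree_Node is_ctor_def)
qed

section \<open>Trees representing numbers, lists and recursive functions\<close>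

primrec nat_tree :: "nat \<Rightarrow> ctree" where
  "nat_tree 0 = Node (0, 0) []"
| "nat_tree (Suc n) = Node (0, 1) [nat_tree n]"

primrec nats_tree :: "nat list \<Rightarrow> ctree" where
  "nats_tree [] = Node (1, 0) []"
| "nats_tree (n # ns) = Node (1, 1) [nat_tree n, nats_tree ns]"

text \<open>Taking trees instead of functions lets \<open>recf_tree\<close> recurse through
  \<open>map\<close> in the case of \<open>Comp\<close>.\<close>

definition recfs_of_trees :: "ctree list \<Rightarrow> ctree" where
  "recfs_of_trees ts = foldr (\<lambda>t u. Node (3, 1) [t, u]) ts (Node (3, 0) [])"

primrec recf_tree :: "recf \<Rightarrow> ctree" where
  "recf_tree Zero = Node (2, 0) []"
| "recf_tree Succ = Node (2, 1) []"
| "recf_tree (Proj i) = Node (2, 2) [nat_tree i]"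
| "recf_tree (Comp f gs) = Node (2, 3) [recf_tree f, recfs_of_trees (map recf_tree gs)]"
| "recf_tree (PrimRec f g) = Node (2, 4) [recf_tree f, recf_tree g]"
| "recf_tree (Mu f) = Node (2, 5) [recf_tree f]"

definition recfs_tree :: "recf list \<Rightarrow> ctree" where
  "recfs_tree fs = recfs_of_trees (map recf_tree fs)"

lemma recfs_tree_simps:
  "recfs_tree [] = Node (3, 0) []"
  "recfs_tree (f # fs) = Node (3, 1) [recf_tree f, recfs_tree fs]"
  by (simp_all add: recfs_tree_def recfs_of_trees_def)

lemma recf_tree_Comp: "recf_tree (Comp f gs) = Node (2, 3) [recf_tree f, recfs_tree gs]"
  by (simp add: recfs_tree_def)

lemma nat_tree_inject [simp]: "nat_tree m = nat_tree n \<longleftrightarrow> m = n"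
proof (induction m arbitrary: n)
  case 0 then show ?case by (cases n) auto
next
  case (Suc m) then show ?case by (cases n) auto
qed

lemma nats_tree_inject [simp]: "nats_tree ms = nats_tree ns \<longleftrightarrow> ms = ns"
proof (induction ms arbitrary: ns)
  case Nil then show ?case by (cases ns) auto
next
  case (Cons m ms) then show ?case by (cases ns) auto
qed

lemma recfs_of_trees_inject: "recfs_of_trees ts = recfs_of_trees us \<longleftrightarrow> ts = us"
  unfolding recfs_of_trees_def
proof (induction ts arbitrary: us)
  case Nil then show ?case by (cases us) auto
next
  case (Cons t ts) then show ?case by (cases us) auto
qed

lemma recf_tree_inject [simp]: "recf_tree f = recf_tree g \<longleftrightarrow> f = g"
proof (induction f arbitrary: g)
  case Zero show ?case by (cases g) auto
next
  case Succ show ?case by (cases g) auto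
next
  case (Proj i) show ?case by (cases g) auto
next
  case (Comp f gs)
  have "map recf_tree gs = map recf_tree hs \<longleftrightarrow> gs = hs" for hs
    using Comp.IH(2) by (auto simp: list_eq_iff_nth_eq)
  then show ?case
    using Comp.IH(1) by (cases g) (auto simp: recfs_of_trees_inject)
next
  case (PrimRec f1 f2) then show ?case by (cases g) auto
next
  case (Mu f) then show ?case by (cases g) auto
qed

lemma recfs_tree_inject [simp]: "recfs_tree fs = recfs_tree gs \<longleftrightarrow> fs = gs"
  by (auto simp: recfs_tree_def recfs_of_trees_inject inj_map_eq_map inj_def)

lemma nat_tree_sort: "nat_tree n \<in> sort_trees sig 0"
  by (induction n) (subst sort_trees_sig; auto)+

lemma nats_tree_sort: "nats_tree ns \<in> sort_trees sig 1"
  by (induction ns) (subst sort_trees_sig; auto simp: nat_tree_sort)+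

text \<open>The sort of the members is a premise so that the lemma can serve inside the induction on
  functions, in the case of \<open>Comp\<close>.\<close>

lemma recfs_tree_sort':
  "(\<And>f. f \<in> set fs \<Longrightarrow> recf_tree f \<in> sort_trees sig 2) \<Longrightarrow> recfs_tree fs \<in> sort_trees sig 3"
  by (induction fs) (subst sort_trees_sig; auto simp: recfs_tree_simps)+

lemma recf_tree_sort: "recf_tree f \<in> sort_trees sig 2"
proof (induction f)
  case (Comp f gs)
  then show ?case
    unfolding recf_tree_Comp by (subst sort_trees_sig) (auto intro: recfs_tree_sort')
qed (subst sort_trees_sig; auto simp: nat_tree_sort)+

lemma recfs_tree_sort: "recfs_tree fs \<in> sort_trees sig 3"
  by (simp add: recfs_tree_sort' recf_tree_sort)

section \<open>The carriers consist exactly of the representing trees\<close>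

lemma finite_sort_trees: "\<delta> < 5 \<Longrightarrow> t \<in> sort_trees sig \<delta> \<Longrightarrow> finite_tree t"
  by (simp add: sort_trees_def kind_of_sig)

text \<open>Finiteness of datatype trees excludes nonstandard elements, so quantifiers over the sort
  range over the true natural numbers.\<close>

lemma sort_trees_0: "sort_trees sig 0 = range nat_tree"
proof -
  have "t \<in> range nat_tree" if "finite_tree t" "t \<in> sort_trees sig 0" for t
    using that
  proof (induction rule: finite_tree_induct)
    case (Node l ts)
    from sort_trees_sig[THEN iffD1, OF _ Node.prems] obtain c where "l = (0, c)" "c < 2"
      and ts: "list_all2 (\<lambda>d u. u \<in> sort_trees sig d) (ctors sig 0 ! c) ts"
      by auto
    then have "c = 0 \<or> c = 1" by auto
    then show ?case
    proof
      assume "c = 0"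
      then have "Node l ts = nat_tree 0" using ts \<open>l = (0, c)\<close> by simp
      then show ?thesis by blast
    next
      assume "c = 1"
      then obtain t where t: "ts = [t]" "t \<in> sort_trees sig 0"
        using ts by (auto simp: list_all2_Cons1)
      then obtain n where "t = nat_tree n" using Node.IH by auto
      then have "Node l ts = nat_tree (Suc n)" using t \<open>c = 1\<close> \<open>l = (0, c)\<close> by simp
      then show ?thesis by blast
    qed
  qed
  then show ?thesis
    using finite_sort_trees[of 0] nat_tree_sort by auto
qed

lemma sort_trees_1: "sort_trees sig (Suc 0) = range nats_tree"
proof -
  have "t \<in> range nats_tree" if "finite_tree t" "t \<in> sort_trees sig 1" for t
    using that
  proof (induction rule: finite_tree_induct)
    case (Node l ts)
    from sort_trees_sig[THEN iffD1, OF _ Node.prems] obtain c where "l = (1, c)" "c < 2"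
      and ts: "list_all2 (\<lambda>d u. u \<in> sort_trees sig d) (ctors sig 1 ! c) ts"
      by auto
    then have "c = 0 \<or> c = 1" by auto
    then show ?case
    proof
      assume "c = 0"
      then have "Node l ts = nats_tree []" using ts \<open>l = (1, c)\<close> by simp
      then show ?thesis by blast
    next
      assume "c = 1"
      then obtain t u where t: "ts = [t, u]" "t \<in> sort_trees sig 0" "u \<in> sort_trees sig 1"
        using ts by (auto simp: list_all2_Cons1)
      moreover obtain n where "t = nat_tree n" using t(2) by (auto simp: sort_trees_0)
      moreover obtain ns where "u = nats_tree ns" using t Node.IH by auto
      ultimately have "Node l ts = nats_tree (n # ns)" using \<open>c = 1\<close> \<open>l = (1, c)\<close> by simp
      then show ?thesis by blast
    qed
  qed
  then show ?thesis
    using finite_sort_trees[of 1] nats_tree_sort by auto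
qed

text \<open>Sorts 2 and 3 are mutually recursive, so one induction handles both.\<close>

lemma finite_recf_trees:
  assumes "finite_tree t"
  shows "(t \<in> sort_trees sig 2 \<longrightarrow> t \<in> range recf_tree) \<and>
    (t \<in> sort_trees sig 3 \<longrightarrow> t \<in> range recfs_tree)"
  using assms
proof (induction rule: finite_tree_induct)
  case (Node l ts)
  have IH2: "\<exists>f. t = recf_tree f" if "t \<in> set ts" "t \<in> sort_trees sig 2" for t
    using Node.IH[OF that(1)] that(2) by auto
  have IH3: "\<exists>fs. t = recfs_tree fs" if "t \<in> set ts" "t \<in> sort_trees sig 3" for t
    using Node.IH[OF that(1)] that(2) by auto
  have "\<exists>f. Node l ts = recf_tree f" if prem: "Node l ts \<in> sort_trees sig 2"
  proof -
    from sort_trees_sig[THEN iffD1, OF _ prem] obtain c where l: "l = (2, c)" "c < 6"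
      and ts: "list_all2 (\<lambda>d u. u \<in> sort_trees sig d) (ctors sig 2 ! c) ts"
      by auto
    then consider "c = 0" | "c = 1" | "c = 2" | "c = 3" | "c = 4" | "c = 5" by linarith
    then show ?thesis
    proof cases
      case 1
      then show ?thesis using ts l by (intro exI[of _ Zero]) simp
    next
      case 2
      then show ?thesis using ts l by (intro exI[of _ Succ]) simp
    next
      case 3
      then obtain i where "ts = [nat_tree i]"
        using ts by (auto simp: list_all2_Cons1 sort_trees_0)
      then show ?thesis using l 3 by (intro exI[of _ "Proj i"]) simp
    next
      case 4
      then obtain t u where t: "ts = [t, u]" "t \<in> sort_trees sig 2" "u \<in> sort_trees sig 3"
        using ts by (auto simp: list_all2_Cons1)
      then obtain f gs where "t = recf_tree f" "u = recfs_tree gs"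
        using IH2[of t] IH3[of u] by auto
      then show ?thesis
        using t l 4 by (intro exI[of _ "Comp f gs"]) (simp add: recfs_tree_def)
    next
      case 5
      then obtain t u where t: "ts = [t, u]" "t \<in> sort_trees sig 2" "u \<in> sort_trees sig 2"
        using ts by (auto simp: list_all2_Cons1)
      then obtain f g where "t = recf_tree f" "u = recf_tree g"
        using IH2[of t] IH2[of u] by auto
      then show ?thesis using t l 5 by (intro exI[of _ "PrimRec f g"]) simp
    next
      case 6
      then obtain t where t: "ts = [t]" "t \<in> sort_trees sig 2"
        using ts by (auto simp: list_all2_Cons1)
      then obtain f where "t = recf_tree f"
        using IH2[of t] by auto
      then show ?thesis using t l 6 by (intro exI[of _ "Mu f"]) simp
    qed
  qed
  moreover have "\<exists>fs. Node l ts = recfs_tree fs" if prem: "Node l ts \<in> sort_trees sig 3"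
  proof -
    from sort_trees_sig[THEN iffD1, OF _ prem] obtain c where l: "l = (3, c)" "c < 2"
      and ts: "list_all2 (\<lambda>d u. u \<in> sort_trees sig d) (ctors sig 3 ! c) ts"
      by auto
    then consider "c = 0" | "c = 1" by linarith
    then show ?thesis
    proof cases
      case 1
      then show ?thesis using ts l by (intro exI[of _ "[]"]) (simp add: recfs_tree_simps)
    next
      case 2
      then obtain t u where t: "ts = [t, u]" "t \<in> sort_trees sig 2" "u \<in> sort_trees sig 3"
        using ts by (auto simp: list_all2_Cons1)
      then obtain f fs where "t = recf_tree f" "u = recfs_tree fs"
        using IH2[of t] IH3[of u] by auto
      then show ?thesis
        using t l 2 by (intro exI[of _ "f # fs"]) (simp add: recfs_tree_simps)
    qed
  qed
  ultimately show ?case by blast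
qed

lemma sort_trees_2: "sort_trees sig 2 = range recf_tree"
  using finite_recf_trees finite_sort_trees[of 2] recf_tree_sort by auto

lemma sort_trees_3: "sort_trees sig 3 = range recfs_tree"
  using finite_recf_trees finite_sort_trees[of 3] recfs_tree_sort by auto


section \<open>Computations as a Horn theory\<close>

text \<open>
  \<open>E f xs y\<close>: \<open>f\<close> is defined on \<open>xs\<close> with value \<open>y\<close>; \<open>L\<close> is the same for lists of functions;
  \<open>N i xs y\<close>: \<open>y\<close> is at position \<open>i\<close> of \<open>xs\<close>; \<open>S f n xs\<close>: \<open>f\<close> is positive on \<open>i # xs\<close> for \<open>i < n\<close>.
\<close>

definition closed_under_rules ::
  "(recf \<Rightarrow> nat list \<Rightarrow> nat \<Rightarrow> bool) \<Rightarrow> (recf list \<Rightarrow> nat list \<Rightarrow> nat list \<Rightarrow> bool) \<Rightarrow>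
   (nat \<Rightarrow> nat list \<Rightarrow> nat \<Rightarrow> bool) \<Rightarrow> (recf \<Rightarrow> nat \<Rightarrow> nat list \<Rightarrow> bool) \<Rightarrow> bool" where
  "closed_under_rules E L N S \<longleftrightarrow>
    (\<forall>x xs. N 0 (x # xs) x) \<and>
    (\<forall>i x xs y. N i xs y \<longrightarrow> N (Suc i) (x # xs) y) \<and>
    (\<forall>xs. L [] xs []) \<and>
    (\<forall>g gs xs y ys. E g xs y \<longrightarrow> L gs xs ys \<longrightarrow> L (g # gs) xs (y # ys)) \<and>
    (\<forall>f xs. S f 0 xs) \<and>
    (\<forall>f n xs y. S f n xs \<longrightarrow> E f (n # xs) (Suc y) \<longrightarrow> S f (Suc n) xs) \<and>
    (\<forall>xs. E Zero xs 0) \<and>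
    (\<forall>x. E Succ [x] (Suc x)) \<and>
    (\<forall>i xs y. N i xs y \<longrightarrow> E (Proj i) xs y) \<and>
    (\<forall>f gs xs ys z. L gs xs ys \<longrightarrow> E f ys z \<longrightarrow> E (Comp f gs) xs z) \<and>
    (\<forall>f g xs y. E f xs y \<longrightarrow> E (PrimRec f g) (0 # xs) y) \<and>
    (\<forall>f g n xs y z. E (PrimRec f g) (n # xs) y \<longrightarrow> E g (n # y # xs) z \<longrightarrow>
      E (PrimRec f g) (Suc n # xs) z) \<and>
    (\<forall>f n xs. E f (n # xs) 0 \<longrightarrow> S f n xs \<longrightarrow> E (Mu f) xs n)"

text \<open>The intended meaning of the judgements is a model of the Horn clauses.\<close>

lemma computes_closed_under_rules:
  "closed_under_rules computes (\<lambda>gs xs ys. list_all2 (\<lambda>g y. computes g xs y) gs ys)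
    (\<lambda>i xs y. i < length xs \<and> y = xs ! i)
    (\<lambda>f n xs. \<forall>i < n. \<exists>y > 0. computes f (i # xs) y)"
  unfolding closed_under_rules_def
  by (auto intro: computes.intros simp: less_Suc_eq)

text \<open>By induction on the derivation of \<open>computes\<close>. Each premise that is not
  itself a computation is first rebuilt from the clauses for \<open>L\<close>, \<open>N\<close> or
  \<open>S\<close>.\<close>

lemma computes_least:
  assumes "closed_under_rules E L N S" "computes f xs y"
  shows "E f xs y"
proof -
  note R = assms(1)[unfolded closed_under_rules_def]
  have nth: "i < length xs \<Longrightarrow> N i xs (xs ! i)" for i xs
  proof (induction xs arbitrary: i)
    case (Cons x xs)
    then show ?case using R by (cases i) auto
  qed simp
  show ?thesis
    using assms(2)
  proof induction
    case (Comp xs gs ys f z)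
    from Comp.IH(1) have "L gs xs ys"
      by (induction rule: list_all2_induct) (simp_all add: R)
    with Comp.IH(2) show ?case using R by blast
  next
    case (Mu f n xs)
    \<comment> \<open>The hypotheses of minimization reach only below \<open>n\<close>, so the
      clauses for \<open>S\<close> are iterated up to that bound.\<close>
    have "S f m xs" if "m \<le> n" for m
      using that
    proof (induction m)
      case (Suc m)
      then obtain y where "y > 0" "E f (m # xs) y" using Mu.IH(2) by (meson Suc_le_lessD)
      \<comment> \<open>The clause for \<open>S\<close> expresses positivity by a successor.\<close>
      then have "E f (m # xs) (Suc (y - 1))" by simp
      then show ?case using R Suc by (meson Suc_leD)
    qed (simp add: R)
    with Mu.IH(1) show ?case by (simp add: R)
  next
    case (Proj i xs)
    then show ?case by (simp add: R nth)
  qed (use R in metis)+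
qed


section \<open>The sentences\<close>

abbreviation (input) "Z\<^sub>t \<equiv> Con 0 0 []"
abbreviation (input) "S\<^sub>t t \<equiv> Con 0 1 [t]"
abbreviation (input) "Nil\<^sub>t \<equiv> Con 1 0 []"
abbreviation (input) "Cons\<^sub>t t u \<equiv> Con 1 1 [t, u]"
text \<open>For \<open>c\<close> other than 4 the selector is applied to a tree with the wrong root,
  where its value is arbitrary. Comparing this value with zero yields a free predicate on
  judgements.\<close>

abbreviation (input) "holds c ts \<equiv> Eq (Sel 4 4 0 (Con 4 c ts)) Z\<^sub>t"

definition horn :: "(nat \<times> nat) list \<Rightarrow> fm list \<Rightarrow> fm \<Rightarrow> fm" where
  "horn vs ps \<phi> = foldr (\<lambda>(\<delta>, x). All \<delta> x) vs (foldr Imp ps \<phi>)"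

text \<open>The clauses of \<open>closed_under_rules\<close>, with clauses, quantifiers and premises
  in the same order.\<close>

definition rule_axioms :: "fm list" where
  "rule_axioms = (let
      n = Var 0 0; x = Var 0 1; y = Var 0 2; z = Var 0 3; xs = Var 1 0; ys = Var 1 1;
      f = Var 2 0; g = Var 2 1; gs = Var 3 0;
      E = (\<lambda>f xs y. holds 0 [f, xs, y]); L = (\<lambda>gs xs ys. holds 1 [gs, xs, ys]);
      N = (\<lambda>i xs y. holds 2 [i, xs, y]); S = (\<lambda>f n xs. holds 3 [f, n, xs])
    in
    [horn [(0, 1), (1, 0)] [] (N Z\<^sub>t (Cons\<^sub>t x xs) x),
     horn [(0, 0), (0, 1), (1, 0), (0, 2)] [N n xs y] (N (S\<^sub>t n) (Cons\<^sub>t x xs) y),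
     horn [(1, 0)] [] (L (Con 3 0 []) xs Nil\<^sub>t),
     horn [(2, 1), (3, 0), (1, 0), (0, 2), (1, 1)] [E g xs y, L gs xs ys]
       (L (Con 3 1 [g, gs]) xs (Cons\<^sub>t y ys)),
     horn [(2, 0), (1, 0)] [] (S f Z\<^sub>t xs),
     horn [(2, 0), (0, 0), (1, 0), (0, 2)] [S f n xs, E f (Cons\<^sub>t n xs) (S\<^sub>t y)] (S f (S\<^sub>t n) xs),
     horn [(1, 0)] [] (E (Con 2 0 []) xs Z\<^sub>t),
     horn [(0, 1)] [] (E (Con 2 1 []) (Cons\<^sub>t x Nil\<^sub>t) (S\<^sub>t x)),
     horn [(0, 0), (1, 0), (0, 2)] [N n xs y] (E (Con 2 2 [n]) xs y),
     horn [(2, 0), (3, 0), (1, 0), (1, 1), (0, 3)] [L gs xs ys, E f ys z] (E (Con 2 3 [f, gs]) xs z),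
     horn [(2, 0), (2, 1), (1, 0), (0, 2)] [E f xs y] (E (Con 2 4 [f, g]) (Cons\<^sub>t Z\<^sub>t xs) y),
     horn [(2, 0), (2, 1), (0, 0), (1, 0), (0, 2), (0, 3)]
       [E (Con 2 4 [f, g]) (Cons\<^sub>t n xs) y, E g (Cons\<^sub>t n (Cons\<^sub>t y xs)) z]
       (E (Con 2 4 [f, g]) (Cons\<^sub>t (S\<^sub>t n) xs) z),
     horn [(2, 0), (0, 0), (1, 0)] [E f (Cons\<^sub>t n xs) Z\<^sub>t, S f n xs] (E (Con 2 5 [f]) xs n)])"

primrec nat_tm :: "nat \<Rightarrow> tm" where
  "nat_tm 0 = Z\<^sub>t"
| "nat_tm (Suc n) = S\<^sub>t (nat_tm n)"

primrec recf_tm :: "recf \<Rightarrow> tm" where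
  "recf_tm Zero = Con 2 0 []"
| "recf_tm Succ = Con 2 1 []"
| "recf_tm (Proj i) = Con 2 2 [nat_tm i]"
| "recf_tm (Comp f gs) =
    Con 2 3 [recf_tm f, foldr (\<lambda>t u. Con 3 1 [t, u]) (map recf_tm gs) (Con 3 0 [])]"
| "recf_tm (PrimRec f g) = Con 2 4 [recf_tm f, recf_tm g]"
| "recf_tm (Mu f) = Con 2 5 [recf_tm f]"

text \<open>The only free variable, \<open>Var 0 0\<close>, stands for the argument of
  \<open>f\<close>. The axioms bind the same variable but are closed, so they do not
  interfere.\<close>

definition value_zero_fm :: "recf \<Rightarrow> fm" where
  "value_zero_fm f =
    foldr Imp rule_axioms (holds 0 [recf_tm f, Cons\<^sub>t (Var 0 0) Nil\<^sub>t, Z\<^sub>t])"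

text \<open>A guarded quantifier replaces substitution: the code of the result is then assembled
  around the code of \<open>\<phi>\<close>, which is never taken apart.\<close>

definition instantiate :: "nat \<Rightarrow> fm \<Rightarrow> fm" where
  "instantiate n \<phi> = All 0 0 (Imp (Eq (Var 0 0) (nat_tm n)) \<phi>)"

lemma nat_tm_wf [simp]: "has_sort sig (nat_tm n) 0" "vars_tm (nat_tm n) = {}"
  by (induction n) (auto simp: is_ctor_def)

lemma recf_tm_wf [simp]: "has_sort sig (recf_tm f) 2 \<and> vars_tm (recf_tm f) = {}"
proof (induction f)
  case (Comp f gs)
  have "has_sort sig (foldr (\<lambda>t u. Con 3 1 [t, u]) (map recf_tm gs) (Con 3 0 [])) 3 \<and>
    vars_tm (foldr (\<lambda>t u. Con 3 1 [t, u]) (map recf_tm gs) (Con 3 0 [])) = {}"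
    using Comp.IH(2) by (induction gs) (auto simp: is_ctor_def)
  then show ?case using Comp.IH(1) by (auto simp: is_ctor_def)
qed (auto simp: is_ctor_def)

lemma sentence_instantiate: "sentence sig (instantiate n (value_zero_fm f))"
proof -
  have "\<forall>\<phi> \<in> set rule_axioms. wf_fm sig \<phi> \<and> free_vars \<phi> = {}"
    by (auto simp: rule_axioms_def horn_def is_ctor_def is_sel_def Let_def)
  moreover have "wf_fm sig (foldr Imp \<phi>s \<psi>) \<longleftrightarrow> (\<forall>\<phi> \<in> set \<phi>s. wf_fm sig \<phi>) \<and> wf_fm sig \<psi>"
    and "free_vars (foldr Imp \<phi>s \<psi>) = (\<Union>\<phi> \<in> set \<phi>s. free_vars \<phi>) \<union> free_vars \<psi>" for \<phi>s \<psi>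
    by (induction \<phi>s) auto
  ultimately show ?thesis
    by (auto simp: sentence_def instantiate_def value_zero_fm_def is_ctor_def is_sel_def)
qed


section \<open>Truth in all structures\<close>

text \<open>The predicate that \<open>M\<close> hides in its choice of selector values on wrong
  constructors.\<close>

definition marked :: "ctree fo_structure \<Rightarrow> nat \<Rightarrow> ctree list \<Rightarrow> bool" where
  "marked M c ts \<longleftrightarrow> sel_interp M 4 4 0 (Node (4, c) ts) = nat_tree 0"

context
  fixes M
  assumes M: "codt_structure sig M"
begin

lemma carrier_sig:
  "carrier M 0 = range nat_tree" "carrier M (Suc 0) = range nats_tree"
  "carrier M 2 = range recf_tree" "carrier M 3 = range recfs_tree"
  using M by (auto simp: codt_structure_def sort_trees_0 sort_trees_1 sort_trees_2 sort_trees_3)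

text \<open>Constructors are fixed only on arguments from the carriers, hence the instances at
  representing trees. The rules fold towards the representations, so later proofs remove the
  unfolding equations from the simpset. Judgements stay in \<open>Node\<close> form to match
  \<open>marked\<close>.\<close>

lemma con_interp_sig:
  "con_interp M 0 0 [] = nat_tree 0"
  "con_interp M 0 (Suc 0) [nat_tree n] = nat_tree (Suc n)"
  "con_interp M (Suc 0) 0 [] = nats_tree []"
  "con_interp M (Suc 0) (Suc 0) [nat_tree n, nats_tree ns] = nats_tree (n # ns)"
  "con_interp M 2 0 [] = recf_tree Zero"
  "con_interp M 2 (Suc 0) [] = recf_tree Succ"
  "con_interp M 2 2 [nat_tree n] = recf_tree (Proj n)"
  "con_interp M 2 3 [recf_tree f, recfs_tree gs] = recf_tree (Comp f gs)"
  "con_interp M 2 4 [recf_tree f, recf_tree g] = recf_tree (PrimRec f g)"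
  "con_interp M 2 5 [recf_tree f] = recf_tree (Mu f)"
  "con_interp M 3 0 [] = recfs_tree []"
  "con_interp M 3 (Suc 0) [recf_tree f, recfs_tree gs] = recfs_tree (f # gs)"
  "con_interp M 4 0 [recf_tree f, nats_tree xs, nat_tree y] =
    Node (4, 0) [recf_tree f, nats_tree xs, nat_tree y]"
  "con_interp M 4 (Suc 0) [recfs_tree fs, nats_tree xs, nats_tree ys] =
    Node (4, 1) [recfs_tree fs, nats_tree xs, nats_tree ys]"
  "con_interp M 4 2 [nat_tree i, nats_tree xs, nat_tree y] =
    Node (4, 2) [nat_tree i, nats_tree xs, nat_tree y]"
  "con_interp M 4 3 [recf_tree f, nat_tree n, nats_tree xs] =
    Node (4, 3) [recf_tree f, nat_tree n, nats_tree xs]"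
proof -
  have con: "con_interp M \<delta> c ts = Node (\<delta>, c) ts"
    if "is_ctor sig \<delta> c" "list_all2 (\<lambda>t \<delta>'. t \<in> carrier M \<delta>') ts (ctors sig \<delta> ! c)" for \<delta> c ts
    using M that unfolding codt_structure_def by blast
  show
    "con_interp M 0 0 [] = nat_tree 0"
    "con_interp M 0 (Suc 0) [nat_tree n] = nat_tree (Suc n)"
    "con_interp M (Suc 0) 0 [] = nats_tree []"
    "con_interp M (Suc 0) (Suc 0) [nat_tree n, nats_tree ns] = nats_tree (n # ns)"
    "con_interp M 2 0 [] = recf_tree Zero"
    "con_interp M 2 (Suc 0) [] = recf_tree Succ"
    "con_interp M 2 2 [nat_tree n] = recf_tree (Proj n)"
    "con_interp M 2 3 [recf_tree f, recfs_tree gs] = recf_tree (Comp f gs)"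
    "con_interp M 2 4 [recf_tree f, recf_tree g] = recf_tree (PrimRec f g)"
    "con_interp M 2 5 [recf_tree f] = recf_tree (Mu f)"
    "con_interp M 3 0 [] = recfs_tree []"
    "con_interp M 3 (Suc 0) [recf_tree f, recfs_tree gs] = recfs_tree (f # gs)"
    "con_interp M 4 0 [recf_tree f, nats_tree xs, nat_tree y] =
      Node (4, 0) [recf_tree f, nats_tree xs, nat_tree y]"
    "con_interp M 4 (Suc 0) [recfs_tree fs, nats_tree xs, nats_tree ys] =
      Node (4, 1) [recfs_tree fs, nats_tree xs, nats_tree ys]"
    "con_interp M 4 2 [nat_tree i, nats_tree xs, nat_tree y] =
      Node (4, 2) [nat_tree i, nats_tree xs, nat_tree y]"
    "con_interp M 4 3 [recf_tree f, nat_tree n, nats_tree xs] =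
      Node (4, 3) [recf_tree f, nat_tree n, nats_tree xs]"
    by (subst con;
        simp add: is_ctor_def carrier_sig recfs_tree_simps recf_tree_Comp del: recf_tree.simps(4))+
qed

lemma eval_nat_tm: "eval_tm M v (nat_tm n) = nat_tree n"
  by (induction n) (auto simp: con_interp_sig simp del: nat_tree.simps)

lemma eval_recf_tm: "eval_tm M v (recf_tm f) = recf_tree f"
proof (induction f)
  case (Comp f gs)
  have "eval_tm M v (foldr (\<lambda>t u. Con 3 1 [t, u]) (map recf_tm gs) (Con 3 0 [])) = recfs_tree gs"
    using Comp.IH(2) by (induction gs) (auto simp: con_interp_sig)
  then show ?case
    using Comp.IH(1) by (simp add: con_interp_sig del: recf_tree.simps)
qed (simp_all add: con_interp_sig eval_nat_tm del: recf_tree.simps)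

text \<open>Since the carriers are ranges of the representations, first-order quantifiers become
  quantifiers over numbers, lists and functions.\<close>

lemma sat_rule_axioms:
  "(\<forall>\<phi> \<in> set rule_axioms. sat M v \<phi>) \<longleftrightarrow>
    closed_under_rules (\<lambda>f xs y. marked M 0 [recf_tree f, nats_tree xs, nat_tree y])
      (\<lambda>fs xs ys. marked M 1 [recfs_tree fs, nats_tree xs, nats_tree ys])
      (\<lambda>i xs y. marked M 2 [nat_tree i, nats_tree xs, nat_tree y])
      (\<lambda>f n xs. marked M 3 [recf_tree f, nat_tree n, nats_tree xs])"
  by (simp add: rule_axioms_def horn_def closed_under_rules_def marked_def Let_def carrier_sig
      con_interp_sig del: nat_tree.simps nats_tree.simps recf_tree.simps)

lemma sat_instantiate:
  "sat M v (instantiate n (value_zero_fm f)) \<longleftrightarrow>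
    (closed_under_rules (\<lambda>f xs y. marked M 0 [recf_tree f, nats_tree xs, nat_tree y])
      (\<lambda>fs xs ys. marked M 1 [recfs_tree fs, nats_tree xs, nats_tree ys])
      (\<lambda>i xs y. marked M 2 [nat_tree i, nats_tree xs, nat_tree y])
      (\<lambda>f n xs. marked M 3 [recf_tree f, nat_tree n, nats_tree xs]) \<longrightarrow>
    marked M 0 [recf_tree f, nats_tree [n], nat_tree 0])"
proof -
  have "sat M w (foldr Imp \<phi>s \<psi>) \<longleftrightarrow> ((\<forall>\<phi> \<in> set \<phi>s. sat M w \<phi>) \<longrightarrow> sat M w \<psi>)" for w \<phi>s \<psi>
    by (induction \<phi>s) auto
  then show ?thesis
    by (simp add: instantiate_def value_zero_fm_def sat_rule_axioms carrier_sig eval_nat_tm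
        eval_recf_tm con_interp_sig marked_def del: nat_tree.simps nats_tree.simps recf_tree.simps)
qed

end

section \<open>The structure marking exactly the true judgements\<close>

definition true_judgements :: "ctree set" where
  "true_judgements =
    {Node (4, 0) [recf_tree f, nats_tree xs, nat_tree y] | f xs y. computes f xs y} \<union>
    {Node (4, 1) [recfs_tree fs, nats_tree xs, nats_tree ys] | fs xs ys.
      list_all2 (\<lambda>g y. computes g xs y) fs ys} \<union>
    {Node (4, 2) [nat_tree i, nats_tree xs, nat_tree y] | i xs y. i < length xs \<and> y = xs ! i} \<union>
    {Node (4, 3) [recf_tree f, nat_tree n, nats_tree xs] | f n xs.
      \<forall>i < n. \<exists>y > 0. computes f (i # xs) y}"

definition default_tree :: "nat \<Rightarrow> ctree" where
  "default_tree \<delta> = (if \<delta> = 4 then Node (4, 4) [nat_tree 0] else Node (\<delta>, 0) [])"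

text \<open>The first branch of the selector is forced by the standard semantics. The second sets
  the free predicate, with 1 as a value other than zero. The last only has to land in the right
  carrier.\<close>

definition intended :: "ctree fo_structure" where
  "intended = \<lparr>carrier = sort_trees sig, con_interp = (\<lambda>\<delta> c. Node (\<delta>, c)),
    sel_interp = (\<lambda>\<delta> c j t. if label t = (\<delta>, c) then children t ! j
      else if \<delta> = 4 \<and> c = 4 then nat_tree (if t \<in> true_judgements then 0 else 1)
      else default_tree (ctors sig \<delta> ! c ! j))\<rparr>"

lemma default_tree_sort: "\<delta> < 5 \<Longrightarrow> default_tree \<delta> \<in> sort_trees sig \<delta>"
  by (subst sort_trees_sig)
    (auto simp: default_tree_def less_5_iff sort_trees_0 simp del: nat_tree.simps)

lemma codt_structure_intended: "codt_structure sig intended"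
  unfolding codt_structure_def
proof (intro conjI allI impI ballI)
  fix \<delta> c j t
  assume sel: "is_sel sig \<delta> c j" and "t \<in> carrier intended \<delta>"
  then have t: "t \<in> sort_trees sig \<delta>" and c: "is_ctor sig \<delta> c" and \<delta>: "\<delta> < 5"
    by (auto simp: intended_def is_sel_def is_ctor_def)
  have arg: "ctors sig \<delta> ! c ! j < 5"
    using sel by (intro args_sig[OF c]) (auto simp: is_sel_def)
  show "sel_interp intended \<delta> c j t \<in> carrier intended (ctors sig \<delta> ! c ! j)"
  proof (cases "label t = (\<delta>, c)")
    case True
    then show ?thesis
      using t sel \<delta> by (subst (asm) sort_trees_sig)
        (auto simp: intended_def is_sel_def list_all2_conv_all_nth)
  next
    case False
    then show ?thesis
      using sel default_tree_sort[OF arg]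
      by (auto simp: intended_def is_sel_def nat_tree_sort simp del: nat_tree.simps)
  qed
qed (auto simp: intended_def)

text \<open>The roots 0 to 3 avoid the forced branch. Distinct labels and injective representations
  let each judgement be recovered from its tree.\<close>

lemma marked_intended:
  "marked intended 0 [recf_tree f, nats_tree xs, nat_tree y] \<longleftrightarrow> computes f xs y"
  "marked intended 1 [recfs_tree fs, nats_tree xs, nats_tree ys] \<longleftrightarrow>
    list_all2 (\<lambda>g y. computes g xs y) fs ys"
  "marked intended 2 [nat_tree i, nats_tree xs, nat_tree y] \<longleftrightarrow> i < length xs \<and> y = xs ! i"
  "marked intended 3 [recf_tree f, nat_tree n, nats_tree xs] \<longleftrightarrow>
    (\<forall>i < n. \<exists>y > 0. computes f (i # xs) y)"
  by (auto simp: marked_def intended_def true_judgements_def simp del: nat_tree.simps)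

text \<open>Truth in \<open>intended\<close> gives the computation, because the marked judgements
  there are the true ones and satisfy the clauses. Conversely, leastness of \<open>computes\<close>
  makes every structure satisfying the clauses mark the computation.\<close>

lemma instantiate_in_theory_iff:
  "instantiate n (value_zero_fm f) \<in> codt_theory sig \<longleftrightarrow> computes f [n] 0"
proof
  assume "instantiate n (value_zero_fm f) \<in> codt_theory sig"
  \<comment> \<open>Truth quantifies over valuations, so one must be exhibited before it can be
    used.\<close>
  moreover have "valuation sig intended (\<lambda>(\<delta>, x). default_tree \<delta>)"
    using default_tree_sort by (simp add: valuation_def intended_def)
  ultimately have "sat intended (\<lambda>(\<delta>, x). default_tree \<delta>) (instantiate n (value_zero_fm f))"
    using codt_structure_intended by (auto simp: codt_theory_def true_in_def)
  then show "computes f [n] 0"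
    using computes_closed_under_rules
    unfolding sat_instantiate[OF codt_structure_intended] marked_intended by blast
next
  assume "computes f [n] 0"
  then have "sat M v (instantiate n (value_zero_fm f))" if "codt_structure sig M" for M v
    unfolding sat_instantiate[OF that] using computes_least by blast
  then show "instantiate n (value_zero_fm f) \<in> codt_theory sig"
    by (simp add: codt_theory_def true_in_def sentence_instantiate)
qed


section \<open>Diagonalization\<close>

lemma computes_Comp1: "computes g xs y \<Longrightarrow> computes f [y] z \<Longrightarrow> computes (Comp f [g]) xs z"
  by (rule computes.Comp[where ys = "[y]"]) auto

lemma computes_Comp2:
  "computes g xs y \<Longrightarrow> computes h xs z \<Longrightarrow> computes f [y, z] u \<Longrightarrow> computes (Comp f [g, h]) xs u"
  by (rule computes.Comp[where ys = "[y, z]"]) auto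

lemma computes_Proj: "i < length xs \<Longrightarrow> y = xs ! i \<Longrightarrow> computes (Proj i) xs y"
  by (simp add: computes.Proj)

primrec const_recf :: "nat \<Rightarrow> recf" where
  "const_recf 0 = Zero"
| "const_recf (Suc n) = Comp Succ [const_recf n]"

lemma computes_const: "computes (const_recf n) xs n"
  by (induction n) (auto intro: computes.Zero computes.Succ computes_Comp1)

text \<open>The step function of a primitive recursion receives the counter, then the previous
  value, so \<open>Proj 1\<close> is the previous value.\<close>

definition add_recf :: recf where
  "add_recf = PrimRec (Proj 0) (Comp Succ [Proj 1])"

lemma computes_add: "computes add_recf [m, n] (m + n)"
  unfolding add_recf_def
  by (induction m)
    (auto intro!: computes.PrimRec_0 computes.Succ computes_Comp1 computes_Proj
      intro: computes.PrimRec_Suc)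

text \<open>Follows \<open>triangle (Suc n) = Suc (triangle n + n)\<close>; triangular numbers occur
  in \<open>prod_encode\<close>.\<close>

definition triangle_recf :: recf where
  "triangle_recf = PrimRec Zero (Comp Succ [Comp add_recf [Proj 1, Proj 0]])"

lemma computes_triangle: "computes triangle_recf [n] (triangle n)"
  unfolding triangle_recf_def
proof (induction n)
  case (Suc n)
  have "computes (Comp Succ [Comp add_recf [Proj 1, Proj 0]]) [n, triangle n] (Suc (triangle n + n))"
    by (rule computes_Comp1[OF computes_Comp2[OF _ _ computes_add] computes.Succ])
      (auto intro: computes_Proj)
  with Suc show ?case by (auto intro: computes.PrimRec_Suc)
qed (auto intro: computes.intros)

definition pair_recf :: recf where
  "pair_recf = Comp add_recf [Comp triangle_recf [add_recf], Proj 0]"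

lemma computes_pair: "computes pair_recf [m, n] (prod_encode (m, n))"
  unfolding pair_recf_def prod_encode_def prod.case
  by (rule computes_Comp2[OF computes_Comp1[OF computes_add computes_triangle] _ computes_add])
    (simp add: computes_Proj)

primrec list_recf :: "recf list \<Rightarrow> recf" where
  "list_recf [] = Zero"
| "list_recf (f # fs) = Comp Succ [Comp pair_recf [f, list_recf fs]]"

lemma computes_list:
  "list_all2 (\<lambda>f y. computes f xs y) fs ys \<Longrightarrow> computes (list_recf fs) xs (list_encode ys)"
  by (induction rule: list_all2_induct)
    (auto intro: computes.Zero computes.Succ computes_Comp1 computes_Comp2 computes_pair)

text \<open>A successor term has the code of the list of the tag 1 of \<open>Con\<close>, sort 0,
  constructor 1 and the code of its argument.\<close>

definition nat_tm_recf :: recf where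
  "nat_tm_recf = PrimRec (const_recf (encode_tm (nat_tm 0)))
    (list_recf [const_recf 1, const_recf 0, const_recf 1, Proj 1])"

lemma computes_nat_tm: "computes nat_tm_recf [n] (encode_tm (nat_tm n))"
  unfolding nat_tm_recf_def
proof (induction n)
  case (Suc n)
  have "computes (list_recf [const_recf 1, const_recf 0, const_recf 1, Proj 1])
      [n, encode_tm (nat_tm n)] (list_encode [1, 0, 1, encode_tm (nat_tm n)])"
    by (intro computes_list) (simp add: computes_const computes_Proj del: const_recf.simps)
  with Suc show ?case
    by (simp only: nat_tm.simps encode_tm.simps list.map computes.PrimRec_Suc)
qed (rule computes.PrimRec_0[OF computes_const])

text \<open>The tags 6, 5 and 0 are those of \<open>All\<close>, \<open>Imp\<close> and
  \<open>Eq\<close>. The input occurs twice: as the number turned into a numeral, and through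
  \<open>Proj 0\<close> as the code of the body.\<close>

definition diag_recf :: recf where
  "diag_recf = Comp pair_recf [const_recf (encode_signature sig),
    list_recf [const_recf 6, const_recf 0, const_recf 0,
      list_recf [const_recf 5,
        list_recf [const_recf 0, const_recf (encode_tm (Var 0 0)), nat_tm_recf], Proj 0]]]"

lemma computes_diag:
  "computes diag_recf [encode_fm \<phi>] (encode_instance (sig, instantiate (encode_fm \<phi>) \<phi>))"
  unfolding diag_recf_def encode_instance_def instantiate_def prod.case encode_fm.simps
  by (intro computes_Comp2[OF _ _ computes_pair] computes_list list.rel_intros computes_const
      computes_nat_tm computes_Proj) simp_all

theorem theorem1:
  "\<not> decidable encode_instance
      {(\<Sigma>, \<phi>). codt_signature \<Sigma> \<and> sentence \<Sigma> \<phi>}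
      {(\<Sigma>, \<phi>). codt_signature \<Sigma> \<and> \<phi> \<in> codt_theory \<Sigma>}"
proof
  assume "decidable encode_instance
      {(\<Sigma>, \<phi>). codt_signature \<Sigma> \<and> sentence \<Sigma> \<phi>}
      {(\<Sigma>, \<phi>). codt_signature \<Sigma> \<and> \<phi> \<in> codt_theory \<Sigma>}"
  then obtain f where f: "\<And>\<phi>. sentence sig \<phi> \<Longrightarrow>
      computes f [encode_instance (sig, \<phi>)] (if \<phi> \<in> codt_theory sig then 1 else 0)"
    unfolding decidable_def using codt_signature_sig by fastforce
  \<comment> \<open>\<open>g\<close> runs the decision procedure on the input formula instantiated
    at its own code. Choosing \<open>n\<close> as the code of the formula for \<open>g\<close>
    having value 0 makes \<open>\<psi>\<close> say that the procedure rejects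
    \<open>\<psi>\<close>.\<close>
  define g where "g = Comp f [diag_recf]"
  define n where "n = encode_fm (value_zero_fm g)"
  define \<psi> where "\<psi> = instantiate n (value_zero_fm g)"
  have "computes g [n] (if \<psi> \<in> codt_theory sig then 1 else 0)"
    unfolding g_def n_def
    by (rule computes_Comp1[OF computes_diag])
      (use f[OF sentence_instantiate, of n g] in \<open>simp add: \<psi>_def n_def g_def\<close>)
  moreover have "\<psi> \<in> codt_theory sig \<longleftrightarrow> computes g [n] 0"
    unfolding \<psi>_def by (rule instantiate_in_theory_iff)
  \<comment> \<open>If \<open>\<psi>\<close> is in the theory, \<open>g\<close> has both values 1
    and 0 at \<open>n\<close>; if not, its value 0 puts \<open>\<psi>\<close> into the
    theory.\<close>
  ultimately show False
    using computes_deterministic by (cases "\<psi> \<in> codt_theory sig") fastforce+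
qed

end
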